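(* With the notation and standing assumptions of the context, consider the CRB minimization problem $$\text{(P1)}\quad \min_{\bm R_x}\ \mathrm{CRB}(\bm\rho)=\sum_{l=1}^L\big(\mathrm{CRB}(\tau_l)+\mathrm{CRB}(\phi_l)\big)\quad\text{s.t.}\quad p_g\mathrm{Tr}(\bm R_x)\le P_0,\quad C_{\mathrm{sum}}(\bm R_x)\ge\Gamma_{\mathrm{th}},$$ over sample covariance matrices $\bm R_x\succeq0$, and the problem $$\text{(P2)}\quad \max_{\bm R_x,\bm\omega,\bm\nu}\ \sum_{l=1}^L\Big(-\frac1{\omega_l}\Big)+\sum_{l=1}^L\Big(-\frac1{\nu_l}\Big)$$ over $\bm R_x\succeq 0$, $\bm\omega=(\omega_1,\dots,\omega_L)$, $\bm\nu=(\nu_1,\dots,\nu_L)$ with $\omega_l,\nu_l>0$, subject to $P_0-p_g\mathrm{Tr}(\bm R_x)\ge0$, $C_{\mathrm{sum}}(\bm R_x)-\Gamma_{\mathrm{th}}\ge0$ and, for all $l\in\{1,\dots,L\}$, $$\begin{bmatrix}\varepsilon_g\overline{F_g^2}f_l(\bm R_x)-\frac{\omega_l}{\xi_l}&|\varepsilon_{\dot g}|g_l(\bm R_x)\\ |\varepsilon_{\dot g}|g_l(\bm R_x)&\varepsilon_gh_l(\bm R_x)\end{bmatrix}\succeq0,\qquad \begin{bmatrix}\varepsilon_gh_l(\bm R_x)-\frac{c_l\nu_l}{\xi_l}&|\varepsilon_{\dot g}|g_l(\bm R_x)\\ |\varepsilon_{\dot g}|g_l(\bm R_x)&\varepsilon_g\overline{F_g^2}f_l(\bm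 R_x)\end{bmatrix}\succeq0.$$ Then (P2) is a convex optimization problem (a concave objective maximized over a convex feasible set), and it is equivalent to (P1): $\bm R_x$ is optimal for (P1) if and only if $(\bm R_x,\bm\omega,\bm\nu)$ is optimal for (P2) for some $\bm\omega,\bm\nu$, and the optimal value of (P2) is the negative of the optimal value of (P1).
   Context: $\bm R_x$ ranges over Hermitian positive semidefinite $M_t\times M_t$ complex matrices. For $l=1,\dots,L$, $\bm H_l=\bm a_r(\phi_l)\bm a_t^T(\theta_l)\in\mathbb C^{M_r\times M_t}$ is a fixed rank-one matrix, with steering vectors $\bm a_t(\theta)=[1,e^{j2\pi\frac{d_T}{\lambda}\sin\theta},\dots,e^{j2\pi\frac{(M_t-1)d_T}{\lambda}\sin\theta}]^T$ and $\bm a_r(\phi)=[1,e^{j2\pi\frac{d_R}{\lambda}\sin\phi},\dots,e^{j2\pi\frac{(M_r-1)d_R}{\lambda}\sin\phi}]^T$. Put $\bm\Lambda=\mathrm{diag}\{0,1,\dots,M_r-1\}$ and $f_l(\bm R_x)=\mathrm{Tr}(\bm H_l\bm R_x\bm H_l^H)$, $g_l(\bm R_x)=\mathrm{Tr}(\bm H_l\bm R_x\bm H_l^H\bm\Lambda^H)$, $h_l(\bm R_x)=\mathrm{Tr}(\bm\Lambda\bm H_l\bm R_x\bm H_l^H\bm\Lambda^H)$. Constants: $\xi_l>0$, $c_l=\frac{\lambda^2}{4\pi^2d_R^2\cos(\phi_l)^2}>0$, $\varepsilon_g=\int_0^{\Delta t}|g|^2dt>0$, $\overline{F_g^2}=\int_0^{\Delta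 t}|\dot g|^2dt/\int_0^{\Delta t}|g|^2dt>0$, $\varepsilon_{\dot g}=\int_0^{\Delta t}(\dot g)^*g\,dt\in\mathbb C$ for a fixed pulse $g$ on $[0,\Delta t]$; $p_g=1$ (average pulse power), power budget $P_0>0$, rate threshold $\Gamma_{\mathrm{th}}$. The individual bounds are $$\mathrm{CRB}(\tau_l)=\frac{\varepsilon_gh_l(\bm R_x)}{\varepsilon_g^2\overline{F_g^2}f_l(\bm R_x)h_l(\bm R_x)-|\varepsilon_{\dot g}|^2g_l^2(\bm R_x)}\cdot\frac1{\xi_l},\quad \mathrm{CRB}(\phi_l)=\frac{\varepsilon_g\overline{F_g^2}f_l(\bm R_x)}{\varepsilon_g^2\overline{F_g^2}f_l(\bm R_x)h_l(\bm R_x)-|\varepsilon_{\dot g}|^2g_l^2(\bm R_x)}\cdot\frac{c_l}{\xi_l}.$$ Standing assumption: for the admissible $\bm R_x$ in (P1), $f_l(\bm R_x)>0$, $h_l(\bm R_x)>0$, and the common denominator $\varepsilon_g^2\overline{F_g^2}f_lh_l-|\varepsilon_{\dot g}|^2g_l^2$ is strictly positive for every $l$ (i.e. (P1) is considered over such $\bm R_x$). The sum rate is $C_{\mathrm{sum}}(\bm R_x)=\frac1N\log_2\det\big(\bm I_L+\frac{N}{\sigma_c^2+\sigma_z^2}\bm F\big)$, where $\bm F$ is the $L\times L$ matrix with $\bm F[i,j]=\mathrm{Tr}(s_is_j\alpha_i\alpha_j\bm H_j\bm R_x\bm H_i^H)$, with real constants $s_i,\alpha_i>0$, $\sigma_c^2+\sigma_z^2>0$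 and $N$ a positive integer. *)

theory Defs
  imports "HOL-Analysis.Analysis"
begin

definition ctranspose :: "complex^'n^'m \<Rightarrow> complex^'m^'n" where
  "ctranspose A = (\<chi> i j. cnj (A $ j $ i))"

text \<open>For Hermitian \<open>A\<close> the quadratic form \<open>v\<^sup>H A v\<close> is real, so \<open>Re\<close> loses nothing.\<close>

definition psd :: "complex^'n^'n \<Rightarrow> bool" where
  "psd A \<longleftrightarrow> ctranspose A = A \<and> (\<forall>v. 0 \<le> Re (\<Sum>i\<in>UNIV. cnj (v $ i) * (A *v v) $ i))"

definition real_psd :: "real^'n^'n \<Rightarrow> bool" where
  "real_psd A \<longleftrightarrow> transpose A = A \<and> (\<forall>v. 0 \<le> v \<bullet> (A *v v))"

text \<open>Antennas are indexed by a finite linearly ordered type \<open>'n\<close>; the position of an antenna is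
  its rank in the order, so positions run through \<open>0, \<dots>, CARD('n) - 1\<close>.\<close>

definition pos :: "'n::{finite,linorder} \<Rightarrow> nat" where
  "pos i = card {k. k < i}"

definition steering :: "real \<Rightarrow> real \<Rightarrow> real \<Rightarrow> complex^'n::{finite,linorder}" where
  "steering d wl angle =
     (\<chi> i. exp (\<i> * complex_of_real (2 * pi * (real (pos i) * d / wl) * sin angle)))"

definition outer_product :: "complex^'m \<Rightarrow> complex^'n \<Rightarrow> complex^'n^'m" where
  "outer_product u v = (\<chi> i j. u $ i * v $ j)"

definition Lam :: "complex^'n::{finite,linorder}^'n::{finite,linorder}" where
  "Lam = (\<chi> i j. if i = j then of_nat (pos i) else 0)"

text \<open>The index type \<open>'l\<close> numbers the propagation paths, \<open>'mt\<close> and \<open>'mr\<close> the transmit and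
  receive antennas. The channel matrices are stored as a field; their form
  \<open>a\<^sub>r(\<phi>\<^sub>l) a\<^sub>t(\<theta>\<^sub>l)\<^sup>T\<close> is imposed as a hypothesis where the model is used.\<close>

record ('l::finite, 'mt::finite, 'mr::finite) isac =
  wavelength :: real
  spacing_T :: real
  spacing_R :: real
  aod :: "'l \<Rightarrow> real"   \<comment> \<open>departure angles \<open>\<theta>\<^sub>l\<close>\<close>
  aoa :: "'l \<Rightarrow> real"   \<comment> \<open>arrival angles \<open>\<phi>\<^sub>l\<close>\<close>
  chan :: "'l \<Rightarrow> complex^'mt^'mr"
  xi :: "'l \<Rightarrow> real"
  pulse :: "real \<Rightarrow> complex"
  duration :: real
  pulse_power :: real
  power_budget :: real
  rate_threshold :: real
  block_length :: nat   \<comment> \<open>\<open>N\<close>\<close>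
  sc :: "'l \<Rightarrow> real"    \<comment> \<open>\<open>s\<^sub>l\<close>\<close>
  alpha :: "'l \<Rightarrow> real"
  sigma_c :: real
  sigma_z :: real

definition c_const :: "('l::finite, 'mt::finite, 'mr::finite) isac \<Rightarrow> 'l \<Rightarrow> real" where
  "c_const S l = (wavelength S)\<^sup>2 / (4 * pi\<^sup>2 * (spacing_R S)\<^sup>2 * (cos (aoa S l))\<^sup>2)"

definition pulse_deriv :: "('l::finite, 'mt::finite, 'mr::finite) isac \<Rightarrow> real \<Rightarrow> complex" where
  "pulse_deriv S t = vector_derivative (pulse S) (at t within {0..duration S})"

definition eps_g :: "('l::finite, 'mt::finite, 'mr::finite) isac \<Rightarrow> real" where
  "eps_g S = integral {0..duration S} (\<lambda>t. (cmod (pulse S t))\<^sup>2)"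

definition F2 :: "('l::finite, 'mt::finite, 'mr::finite) isac \<Rightarrow> real" where
  "F2 S = integral {0..duration S} (\<lambda>t. (cmod (pulse_deriv S t))\<^sup>2)
        / integral {0..duration S} (\<lambda>t. (cmod (pulse S t))\<^sup>2)"

definition eps_dg :: "('l::finite, 'mt::finite, 'mr::finite) isac \<Rightarrow> complex" where
  "eps_dg S = integral {0..duration S} (\<lambda>t. cnj (pulse_deriv S t) * pulse S t)"

text \<open>The traces below, and the determinant in the sum rate, are real for Hermitian \<open>R\<close>
  (see the lemmas \<open>trace_fgh_real\<close> and \<open>det_rate_real\<close>), so \<open>Re\<close> only changes the type.\<close>

definition f_tr :: "('l::finite, 'mt::finite, 'mr::finite) isac \<Rightarrow> 'l \<Rightarrow> complex^'mt^'mt \<Rightarrow> real" where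
  "f_tr S l R = Re (trace (chan S l ** R ** ctranspose (chan S l)))"

definition g_tr :: "('l::finite, 'mt::finite, 'mr::{finite,linorder}) isac \<Rightarrow> 'l \<Rightarrow> complex^'mt^'mt \<Rightarrow> real" where
  "g_tr S l R = Re (trace (chan S l ** R ** ctranspose (chan S l) ** ctranspose Lam))"

definition h_tr :: "('l::finite, 'mt::finite, 'mr::{finite,linorder}) isac \<Rightarrow> 'l \<Rightarrow> complex^'mt^'mt \<Rightarrow> real" where
  "h_tr S l R = Re (trace (Lam ** chan S l ** R ** ctranspose (chan S l) ** ctranspose Lam))"

definition crb_denom :: "('l::finite, 'mt::finite, 'mr::{finite,linorder}) isac \<Rightarrow> 'l \<Rightarrow> complex^'mt^'mt \<Rightarrow> real" where
  "crb_denom S l R = (eps_g S)\<^sup>2 * F2 S * f_tr S l R * h_tr S l R - (cmod (eps_dg S))\<^sup>2 * (g_tr S l R)\<^sup>2"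

definition CRB_tau :: "('l::finite, 'mt::finite, 'mr::{finite,linorder}) isac \<Rightarrow> 'l \<Rightarrow> complex^'mt^'mt \<Rightarrow> real" where
  "CRB_tau S l R = eps_g S * h_tr S l R / crb_denom S l R * (1 / xi S l)"

definition CRB_phi :: "('l::finite, 'mt::finite, 'mr::{finite,linorder}) isac \<Rightarrow> 'l \<Rightarrow> complex^'mt^'mt \<Rightarrow> real" where
  "CRB_phi S l R = eps_g S * F2 S * f_tr S l R / crb_denom S l R * (c_const S l / xi S l)"

definition CRB :: "('l::finite, 'mt::finite, 'mr::{finite,linorder}) isac \<Rightarrow> complex^'mt^'mt \<Rightarrow> real" where
  "CRB S R = (\<Sum>l\<in>UNIV. CRB_tau S l R + CRB_phi S l R)"

definition Fmat :: "('l::finite, 'mt::finite, 'mr::finite) isac \<Rightarrow> complex^'mt^'mt \<Rightarrow> complex^'l^'l" where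
  "Fmat S R = (\<chi> i j. trace ((sc S i * sc S j * alpha S i * alpha S j)
       *\<^sub>R (chan S j ** R ** ctranspose (chan S i))))"

definition C_sum :: "('l::finite, 'mt::finite, 'mr::finite) isac \<Rightarrow> complex^'mt^'mt \<Rightarrow> real" where
  "C_sum S R = 1 / real (block_length S) *
     log 2 (Re (det (mat 1 + (real (block_length S) / ((sigma_c S)\<^sup>2 + (sigma_z S)\<^sup>2)) *\<^sub>R Fmat S R)))"

text \<open>The constraints on \<open>f_tr\<close>, \<open>h_tr\<close> and the denominator are the standing restriction of (P1) to
  those covariance matrices for which the bounds are defined. (P2) carries no such restriction.\<close>

definition P1_feasible :: "('l::finite, 'mt::finite, 'mr::{finite,linorder}) isac \<Rightarrow> (complex^'mt^'mt) set" where
  "P1_feasible S = {R. psd R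
     \<and> (\<forall>l. f_tr S l R > 0 \<and> h_tr S l R > 0 \<and> crb_denom S l R > 0)
     \<and> pulse_power S * Re (trace R) \<le> power_budget S
     \<and> C_sum S R \<ge> rate_threshold S}"

definition LMI_tau ::
  "('l::finite, 'mt::finite, 'mr::{finite,linorder}) isac \<Rightarrow> 'l \<Rightarrow> complex^'mt^'mt \<Rightarrow> real \<Rightarrow> real^2^2" where
  "LMI_tau S l R w = vector
     [vector [eps_g S * F2 S * f_tr S l R - w / xi S l, cmod (eps_dg S) * g_tr S l R],
      vector [cmod (eps_dg S) * g_tr S l R,             eps_g S * h_tr S l R]]"

definition LMI_phi ::
  "('l::finite, 'mt::finite, 'mr::{finite,linorder}) isac \<Rightarrow> 'l \<Rightarrow> complex^'mt^'mt \<Rightarrow> real \<Rightarrow> real^2^2" where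
  "LMI_phi S l R v = vector
     [vector [eps_g S * h_tr S l R - c_const S l * v / xi S l, cmod (eps_dg S) * g_tr S l R],
      vector [cmod (eps_dg S) * g_tr S l R,                    eps_g S * F2 S * f_tr S l R]]"

definition P2_feasible ::
  "('l::finite, 'mt::finite, 'mr::{finite,linorder}) isac \<Rightarrow> ((complex^'mt^'mt) \<times> (real^'l) \<times> (real^'l)) set" where
  "P2_feasible S = {(R, \<omega>, \<nu>). psd R
     \<and> (\<forall>l. \<omega> $ l > 0 \<and> \<nu> $ l > 0)
     \<and> power_budget S - pulse_power S * Re (trace R) \<ge> 0
     \<and> C_sum S R - rate_threshold S \<ge> 0
     \<and> (\<forall>l. real_psd (LMI_tau S l R (\<omega> $ l)) \<and> real_psd (LMI_phi S l R (\<nu> $ l)))}"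

definition P2_objective :: "(complex^'mt^'mt) \<times> (real^'l) \<times> (real^'l) \<Rightarrow> real" where
  "P2_objective = (\<lambda>(R, \<omega>, \<nu>). (\<Sum>l\<in>UNIV. - (1 / \<omega> $ l)) + (\<Sum>l\<in>UNIV. - (1 / \<nu> $ l)))"

lemma ctranspose_nth [simp]: "ctranspose A $ i $ j = cnj (A $ j $ i)"
  by (simp add: ctranspose_def)

lemma ctranspose_ctranspose [simp]: "ctranspose (ctranspose A) = A"
  by (simp add: vec_eq_iff)

lemma ctranspose_mult: "ctranspose (A ** B) = ctranspose B ** ctranspose A"
  by (simp add: vec_eq_iff matrix_matrix_mult_def mult.commute)

lemma trace_ctranspose: "trace (ctranspose A) = cnj (trace A)"
  by (simp add: trace_def)

lemma det_ctranspose: "det (ctranspose A) = cnj (det A)"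
proof -
  have "det (ctranspose A) = det (transpose (ctranspose A))" by (simp add: det_transpose)
  also have "\<dots> = cnj (det A)"
    by (simp add: det_def transpose_def cnj_sum cnj_prod)
  finally show ?thesis .
qed

lemma ctranspose_Lam [simp]: "ctranspose Lam = Lam"
  by (simp add: vec_eq_iff Lam_def)

lemma trace_fgh_real:
  assumes "ctranspose R = R"
  shows "trace (H ** R ** ctranspose H) \<in> \<real>"
    and "trace (H ** R ** ctranspose H ** ctranspose Lam) \<in> \<real>"
    and "trace (Lam ** H ** R ** ctranspose H ** ctranspose Lam) \<in> \<real>"
proof -
  have K: "ctranspose (H ** R ** ctranspose H) = H ** R ** ctranspose H"
    by (simp add: ctranspose_mult assms matrix_mul_assoc)
  have "cnj (trace (H ** R ** ctranspose H)) = trace (H ** R ** ctranspose H)"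
    using K trace_ctranspose by metis
  then show "trace (H ** R ** ctranspose H) \<in> \<real>" by (simp add: Reals_cnj_iff)
  have "cnj (trace (H ** R ** ctranspose H ** Lam)) = trace (Lam ** (H ** R ** ctranspose H))"
    using K ctranspose_mult trace_ctranspose ctranspose_Lam by metis
  also have "\<dots> = trace (H ** R ** ctranspose H ** Lam)" by (rule trace_mul_sym)
  finally show "trace (H ** R ** ctranspose H ** ctranspose Lam) \<in> \<real>"
    by (simp add: Reals_cnj_iff)
  have "ctranspose (Lam ** H ** R ** ctranspose H ** ctranspose Lam)
      = Lam ** H ** R ** ctranspose H ** ctranspose Lam"
    by (simp add: ctranspose_mult assms matrix_mul_assoc)
  then have "cnj (trace (Lam ** H ** R ** ctranspose H ** ctranspose Lam))
      = trace (Lam ** H ** R ** ctranspose H ** ctranspose Lam)"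
    using trace_ctranspose by metis
  then show "trace (Lam ** H ** R ** ctranspose H ** ctranspose Lam) \<in> \<real>"
    by (simp add: Reals_cnj_iff)
qed

lemma det_rate_real:
  assumes "ctranspose R = R"
  shows "det (mat 1 + (r::real) *\<^sub>R Fmat S R) \<in> \<real>"
proof -
  have swap: "cnj (trace (a *\<^sub>R (chan S i ** R ** ctranspose (chan S j))))
      = trace (a *\<^sub>R (chan S j ** R ** ctranspose (chan S i)))" for a :: real and i j
  proof -
    have "ctranspose (chan S i ** R ** ctranspose (chan S j)) = chan S j ** R ** ctranspose (chan S i)"
      by (simp add: ctranspose_mult assms matrix_mul_assoc)
    then have "cnj (trace (chan S i ** R ** ctranspose (chan S j)))
        = trace (chan S j ** R ** ctranspose (chan S i))"
      using trace_ctranspose by metis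
    then show ?thesis
      by (simp add: trace_def scaleR_sum_right[symmetric])
  qed
  have "ctranspose (mat 1 + r *\<^sub>R Fmat S R) = mat 1 + r *\<^sub>R Fmat S R"
    by (auto simp: vec_eq_iff Fmat_def mat_def swap ac_simps)
  then show ?thesis
    using det_ctranspose Reals_cnj_iff by metis
qed

end

theory Submission
  imports Defs "HOL-Computational_Algebra.Fundamental_Theorem_Algebra"
begin

text \<open>Over a fixed covariance \<open>R\<close>, the two matrix inequalities of (P2) say exactly that the
  denominator of the bounds is positive and \<open>\<omega>\<^sub>l \<le> 1 / CRB(\<tau>\<^sub>l)\<close>, \<open>\<nu>\<^sub>l \<le> 1 / CRB(\<phi>\<^sub>l)\<close>, so maximizing
  over \<open>\<omega>\<close> and \<open>\<nu>\<close> returns \<open>- CRB(R)\<close>. The feasible set is convex because the matrix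
  inequalities are affine and the rate is concave in \<open>R\<close>. The latter is log-concavity of the
  determinant, which follows from the real-rootedness of \<open>z \<mapsto> det ((1 - z) A + z B)\<close> for
  positive definite \<open>A\<close> and \<open>B\<close>: on \<open>[0, 1]\<close> its logarithm is, up to a constant, a sum of logarithms
  of positive affine functions.\<close>

section \<open>Hermitian forms and definite matrices\<close>

text \<open>Kept complex-valued, without the \<open>Re\<close> of \<open>psd\<close>, so that it
  stays linear in the matrix when a pencil is evaluated at a complex parameter.\<close>

definition herm_form :: "complex^'n^'n \<Rightarrow> complex^'n \<Rightarrow> complex" where
  "herm_form A v = (\<Sum>i\<in>UNIV. cnj (v $ i) * (A *v v) $ i)"

lemma psd_iff: "psd A \<longleftrightarrow> ctranspose A = A \<and> (\<forall>v. 0 \<le> Re (herm_form A v))"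
  by (simp add: psd_def herm_form_def)

definition pos_def :: "complex^'n^'n \<Rightarrow> bool" where
  "pos_def A \<longleftrightarrow> ctranspose A = A \<and> (\<forall>v. v \<noteq> 0 \<longrightarrow> 0 < Re (herm_form A v))"

lemma herm_form_altdef: "herm_form A v = (\<Sum>i\<in>UNIV. \<Sum>j\<in>UNIV. cnj (v $ i) * A $ i $ j * v $ j)"
  by (simp add: herm_form_def matrix_vector_mult_def sum_distrib_left mult.assoc)

lemma herm_form_real:
  assumes "ctranspose A = A"
  shows "herm_form A v \<in> \<real>"
proof -
  have A: "cnj (A $ i $ j) = A $ j $ i" for i j
    using assms by (metis ctranspose_nth)
  have "cnj (herm_form A v) = (\<Sum>i\<in>UNIV. \<Sum>j\<in>UNIV. v $ i * A $ j $ i * cnj (v $ j))"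
    by (simp add: herm_form_altdef A)
  also have "\<dots> = herm_form A v"
    unfolding herm_form_altdef by (subst sum.swap) (simp add: mult_ac)
  finally show ?thesis
    by (simp add: Reals_cnj_iff)
qed

lemma herm_form_add: "herm_form (A + B) v = herm_form A v + herm_form B v"
  by (simp add: herm_form_def matrix_vector_mult_add_rdistrib distrib_left sum.distrib)

lemma herm_form_scaleR: "herm_form (c *\<^sub>R A) v = c *\<^sub>R herm_form A v"
  by (simp add: herm_form_altdef scaleR_sum_right)

lemma Re_herm_form_mat_1: "Re (herm_form (mat 1) v) = (\<Sum>i\<in>UNIV. (cmod (v $ i))\<^sup>2)"
  by (simp add: herm_form_def cmod_power2) (simp add: power2_eq_square)

lemma ctranspose_add: "ctranspose (A + B) = ctranspose A + ctranspose B"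
  by (simp add: vec_eq_iff)

lemma ctranspose_scaleR: "ctranspose (c *\<^sub>R A) = c *\<^sub>R ctranspose A"
  by (simp add: vec_eq_iff)

lemma convex_psd: "convex {A. psd A}"
  by (auto simp: convex_def psd_iff ctranspose_add ctranspose_scaleR herm_form_add herm_form_scaleR)

lemma pos_def_mat_1_add:
  assumes "psd A" "c \<ge> 0"
  shows "pos_def (mat 1 + c *\<^sub>R A)"
proof -
  have "0 < Re (herm_form (mat 1 + c *\<^sub>R A) v)" if "v \<noteq> 0" for v
  proof -
    obtain i where "v $ i \<noteq> 0"
      using \<open>v \<noteq> 0\<close> by (auto simp: vec_eq_iff)
    then have "0 < Re (herm_form (mat 1) v)"
      unfolding Re_herm_form_mat_1 by (intro sum_pos2[of _ i]) auto
    moreover have "0 \<le> Re (herm_form (c *\<^sub>R A) v)"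
      using assms by (simp add: psd_iff herm_form_scaleR)
    ultimately show ?thesis
      by (simp add: herm_form_add)
  qed
  moreover have "ctranspose (mat 1 :: complex^'a^'a) = mat 1"
    by (simp add: vec_eq_iff mat_def)
  ultimately show ?thesis
    using assms by (simp add: pos_def_def psd_iff ctranspose_add ctranspose_scaleR)
qed

section \<open>Real roots of pencil determinants and log-concavity of the determinant\<close>

text \<open>Written entrywise to admit complex \<open>z\<close>: the roots of the determinant must
  be located in the whole complex plane. For real \<open>z\<close> in [0, 1] this is the segment
  from \<open>A\<close> to \<open>B\<close>.\<close>

definition pencil :: "complex^'n^'n \<Rightarrow> complex^'n^'n \<Rightarrow> complex \<Rightarrow> complex^'n^'n" where
  "pencil A B z = (\<chi> i j. (1 - z) * A $ i $ j + z * B $ i $ j)"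

lemma pencil_of_real: "pencil A B (of_real u) = (1 - u) *\<^sub>R A + u *\<^sub>R B"
  by (simp add: pencil_def vec_eq_iff) (simp add: scaleR_conv_of_real)

lemma herm_form_pencil:
  "herm_form (pencil A B z) v = (1 - z) * herm_form A v + z * herm_form B v"
  by (simp add: herm_form_altdef pencil_def sum_distrib_left flip: sum.distrib)
     (simp add: algebra_simps)

text \<open>Every entry is affine in \<open>z\<close>, so the Leibniz expansion can be carried out
  with polynomials of degree at most one in place of the entries.\<close>

lemma det_pencil_poly: "\<exists>P. \<forall>z. poly P z = det (pencil A B z)"
proof -
  define P where "P = (\<Sum>p | p permutes UNIV. [:of_int (sign p):] *
      (\<Prod>i\<in>UNIV. [:A $ i $ p i, B $ i $ p i - A $ i $ p i:]))"
  have "poly P z = det (pencil A B z)" for z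
    unfolding P_def det_def
    by (simp add: poly_sum poly_prod pencil_def algebra_simps)
  then show ?thesis by blast
qed

text \<open>At a root, a kernel vector \<open>v\<close> turns the pencil into the scalar equation (1
  - z) a + z b = 0, where a, b > 0 are the values of the two forms at \<open>v\<close>. Its solution
  is real, and it avoids [0, 1] because a convex combination of positive numbers is
  positive.\<close>

lemma det_pencil_root_real:
  assumes "pos_def A" "pos_def B" "det (pencil A B z) = 0"
  obtains x where "z = of_real x" "x < 0 \<or> 1 < x"
proof -
  have "\<not> invertible (pencil A B z)"
    using assms(3) by (simp add: invertible_det_nz)
  then obtain v where v: "pencil A B z *v v = 0" "v \<noteq> 0"
    by (metis invertible_left_inverse matrix_left_invertible_ker)
  obtain a b where ab: "herm_form A v = of_real a" "herm_form B v = of_real b"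
    using herm_form_real assms(1,2) unfolding pos_def_def by (metis Reals_cases)
  have pos: "0 < a" "0 < b"
    using assms(1,2) v(2) ab unfolding pos_def_def by (metis Re_complex_of_real)+
  have "herm_form (pencil A B z) v = 0"
    by (simp add: herm_form_def v(1))
  then have eq: "(1 - z) * of_real a + z * of_real b = 0"
    by (simp add: herm_form_pencil ab)
  \<comment> \<open>If \<open>b = a\<close>, the real part of the equation would read
    \<open>a = 0\<close>; hence the other factor \<open>Im z\<close> vanishes.\<close>
  from arg_cong[OF eq, of Im] have "Im z * (b - a) = 0"
    by (simp add: algebra_simps)
  moreover from arg_cong[OF eq, of Re] have re: "(1 - Re z) * a + Re z * b = 0"
    by simp
  ultimately have "Im z = 0"
    using pos by (auto simp: algebra_simps)
  moreover have "Re z < 0 \<or> 1 < Re z"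
  proof (rule ccontr)
    assume "\<not> (Re z < 0 \<or> 1 < Re z)"
    then have "0 \<le> (1 - Re z) * a" "0 \<le> Re z * b" using pos by auto
    with re have "(1 - Re z) * a = 0" "Re z * b = 0" by linarith+
    with pos show False by auto
  qed
  ultimately show ?thesis
    using that[of "Re z"] by (simp add: complex_eq_iff)
qed

lemma ln_concaveD:
  fixes x y :: real
  assumes "0 < x" "0 < y" "0 \<le> u" "u \<le> 1"
  shows "(1 - u) * ln x + u * ln y \<le> ln ((1 - u) * x + u * y)"
  using ln_concave assms unfolding concave_on_iff by force

text \<open>A real root outside [0, 1] lies on one side of the interval, so its distance to
  \<open>t\<close> is positive and affine there and has a concave logarithm. Induction over the
  roots adds these logarithms; positivity is carried along so that \<open>ln\<close> splits over
  products.\<close>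

lemma ln_norm_prod_linear_concave:
  fixes M :: "complex multiset"
  assumes "\<And>z. z \<in># M \<Longrightarrow> \<exists>x. z = of_real x \<and> (x < 0 \<or> 1 < x)" and u: "0 \<le> u" "u \<le> 1"
  defines "q \<equiv> \<lambda>t::real. (\<Prod>z\<in>#M. cmod (of_real t - z))"
  shows "0 < q 0 \<and> 0 < q 1 \<and> 0 < q u \<and> (1 - u) * ln (q 0) + u * ln (q 1) \<le> ln (q u)"
  using assms(1) unfolding q_def
proof (induction M)
  case empty
  then show ?case by simp
next
  case (add z M)
  obtain x where x: "z = of_real x" "x < 0 \<or> 1 < x"
    using add.prems by force
  define l where "l = (\<lambda>t::real. cmod (of_real t - z))"
  have l: "l t = \<bar>t - x\<bar>" for t
    unfolding l_def x(1) by (metis norm_of_real of_real_diff)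
  have pos: "0 < l 0" "0 < l 1" "0 < l u"
    using x(2) u by (auto simp: l)
  have "l u = (1 - u) * l 0 + u * l 1"
    using x(2) u by (auto simp: l algebra_simps)
  then have l_concave: "(1 - u) * ln (l 0) + u * ln (l 1) \<le> ln (l u)"
    using ln_concaveD[OF pos(1,2) u] by simp
  define Q where "Q = (\<lambda>t::real. \<Prod>z\<in>#M. cmod (of_real t - z))"
  have "0 < Q 0 \<and> 0 < Q 1 \<and> 0 < Q u \<and> (1 - u) * ln (Q 0) + u * ln (Q 1) \<le> ln (Q u)"
    unfolding Q_def using add by auto
  moreover have "(\<Prod>z\<in>#add_mset z M. cmod (of_real t - z)) = l t * Q t" for t
    by (simp add: l_def Q_def)
  ultimately show ?case
    using pos l_concave by (simp only:) (simp add: ln_mult_pos algebra_simps)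
qed

text \<open>Since \<open>cmod\<close> is multiplicative, the modulus of the determinant factors over
  the roots, and its sign never has to be discussed.\<close>

lemma ln_det_concave:
  assumes "pos_def A" "pos_def B" "0 \<le> u" "u \<le> 1"
  shows "(1 - u) * ln (cmod (det A)) + u * ln (cmod (det B))
    \<le> ln (cmod (det ((1 - u) *\<^sub>R A + u *\<^sub>R B)))"
proof -
  obtain P where P: "poly P z = det (pencil A B z)" for z
    using det_pencil_poly by metis
  have roots: "\<exists>x. z = of_real x \<and> (x < 0 \<or> 1 < x)" if "poly P z = 0" for z
    using that det_pencil_root_real[OF assms(1,2)] P by metis
  \<comment> \<open>The zero polynomial would have the non-real root \<open>\<i>\<close>.\<close>
  then have "P \<noteq> 0"
    using roots[of \<i>] by (auto simp: complex_eq_iff)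
  then obtain M where M: "P = smult (lead_coeff P) (\<Prod>x\<in>#M. [:-x, 1:])"
    using alg_closed_imp_factorization by blast
  have PM: "poly P z = lead_coeff P * (\<Prod>x\<in>#M. z - x)" for z
    by (subst M) (simp add: poly_prod_mset)
  have "cmod (\<Prod>x\<in>#N. z - x) = (\<Prod>x\<in>#N. cmod (z - x))" for z N
    by (induction N) (simp_all add: norm_mult)
  then have normP: "cmod (det (pencil A B (of_real t))) = cmod (lead_coeff P) * (\<Prod>x\<in>#M. cmod (of_real t - x))"
    for t
    by (simp add: norm_mult PM flip: P)
  have "poly P z = 0" if "z \<in># M" for z
    using that by (auto simp: PM prod_mset_zero_iff)
  with roots have "z \<in># M \<Longrightarrow> \<exists>x. z = of_real x \<and> (x < 0 \<or> 1 < x)" for z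
    by blast
  note concave = ln_norm_prod_linear_concave[OF this assms(3,4)]
  \<comment> \<open>The logarithm of the leading coefficient enters both sides with total weight 1
    and cancels.\<close>
  have "(1 - u) * ln (cmod (det (pencil A B (of_real 0)))) + u * ln (cmod (det (pencil A B (of_real 1))))
    \<le> ln (cmod (det (pencil A B (of_real u))))"
    unfolding normP using concave \<open>P \<noteq> 0\<close> by (simp add: ln_mult_pos algebra_simps)
  then show ?thesis
    unfolding pencil_of_real by simp
qed

section \<open>Linearity of the traces and concavity of the rate\<close>

lemma matrix_mult_scaleR_right: "A ** (c *\<^sub>R B) = c *\<^sub>R (A ** (B :: complex^'n^'m))"
  by (simp add: vec_eq_iff matrix_matrix_mult_def scaleR_sum_right)

lemma matrix_mult_scaleR_left: "(c *\<^sub>R A) ** B = c *\<^sub>R ((A :: complex^'n^'m) ** B)"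
  by (simp add: vec_eq_iff matrix_matrix_mult_def scaleR_sum_right)

lemma matrix_mult_add_left: "(A + B) ** C = A ** C + B ** (C :: complex^'n^'m)"
  by (simp add: vec_eq_iff matrix_matrix_mult_def sum.distrib distrib_right)

lemma trace_scaleR: "trace (c *\<^sub>R A) = c *\<^sub>R trace (A :: complex^'n^'n)"
  by (simp add: trace_def scaleR_sum_right)

lemmas matrix_linear_simps = matrix_add_ldistrib matrix_mult_add_left matrix_mult_scaleR_left
  matrix_mult_scaleR_right trace_add trace_scaleR

lemma linear_f_tr: "linear (f_tr S l)"
  by (rule linearI) (simp_all add: f_tr_def matrix_linear_simps)

lemma linear_g_tr: "linear (g_tr S l)"
  by (rule linearI) (simp_all add: g_tr_def matrix_linear_simps)

lemma linear_h_tr: "linear (h_tr S l)"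
  by (rule linearI) (simp_all add: h_tr_def matrix_linear_simps)

lemma linear_Fmat: "linear (Fmat S)"
  by (rule linearI) (simp_all add: Fmat_def matrix_linear_simps vec_eq_iff algebra_simps)

text \<open>The \<open>k\<close>-th diagonal entry is the form of \<open>R\<close> at the conjugated
  \<open>k\<close>-th row of \<open>B\<close>.\<close>

lemma Re_trace_congruence_nonneg:
  assumes "psd R"
  shows "0 \<le> Re (trace (B ** R ** ctranspose B))"
proof -
  have "trace (B ** R ** ctranspose B) = (\<Sum>k\<in>UNIV. herm_form R (\<chi> i. cnj (B $ k $ i)))"
    unfolding trace_def
  proof (rule sum.cong)
    fix k
    show "(B ** R ** ctranspose B) $ k $ k = herm_form R (\<chi> i. cnj (B $ k $ i))"
      unfolding herm_form_altdef matrix_matrix_mult_def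
      by (subst sum.swap) (simp add: sum_distrib_right)
  qed simp
  then show ?thesis
    using assms by (simp add: psd_iff sum_nonneg)
qed

text \<open>Moves the innermost summation to the front. Two applications bring both path indices
  outside the antenna indices in the expansion of a trace.\<close>

lemma sum_rotate4:
  "(\<Sum>k\<in>A. \<Sum>q\<in>B. \<Sum>p\<in>C. \<Sum>i\<in>D. X k q p i) = (\<Sum>i\<in>D. \<Sum>k\<in>A. \<Sum>q\<in>B. \<Sum>p\<in>C. X k q p i)"
proof -
  have "(\<Sum>k\<in>A. \<Sum>q\<in>B. \<Sum>p\<in>C. \<Sum>i\<in>D. X k q p i) = (\<Sum>k\<in>A. \<Sum>q\<in>B. \<Sum>i\<in>D. \<Sum>p\<in>C. X k q p i)"
    by (intro sum.cong refl) (rule sum.swap)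
  also have "\<dots> = (\<Sum>k\<in>A. \<Sum>i\<in>D. \<Sum>q\<in>B. \<Sum>p\<in>C. X k q p i)"
    by (intro sum.cong refl) (rule sum.swap)
  also have "\<dots> = (\<Sum>i\<in>D. \<Sum>k\<in>A. \<Sum>q\<in>B. \<Sum>p\<in>C. X k q p i)"
    by (rule sum.swap)
  finally show ?thesis .
qed

text \<open>With \<open>B = \<Sum>\<^sub>j v\<^sub>j s\<^sub>j \<alpha>\<^sub>j H\<^sub>j\<close>, the form \<open>v\<^sup>H F v\<close> is \<open>Tr (B R B\<^sup>H)\<close>.\<close>

lemma psd_Fmat:
  assumes "psd R"
  shows "psd (Fmat S R)"
proof -
  have R: "ctranspose R = R" using assms by (simp add: psd_def)
  have entry: "Fmat S R $ i $ j = of_real (sc S i * sc S j * alpha S i * alpha S j)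
      * trace (chan S j ** R ** ctranspose (chan S i))" for i j
    by (simp add: Fmat_def trace_scaleR) (simp add: scaleR_conv_of_real)
  have "ctranspose (chan S i ** R ** ctranspose (chan S j)) = chan S j ** R ** ctranspose (chan S i)" for i j
    by (simp add: ctranspose_mult R matrix_mul_assoc)
  then have "cnj (trace (chan S i ** R ** ctranspose (chan S j)))
      = trace (chan S j ** R ** ctranspose (chan S i))" for i j
    using trace_ctranspose by metis
  then have herm: "ctranspose (Fmat S R) = Fmat S R"
    by (simp add: vec_eq_iff entry mult_ac)
  have "0 \<le> Re (herm_form (Fmat S R) v)" for v
  proof -
    define w where "w = (\<lambda>j. of_real (sc S j * alpha S j) * v $ j)"
    define B where "B = (\<chi> k i. \<Sum>j\<in>UNIV. w j * chan S j $ k $ i)"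
    have tr: "trace (X ** R ** ctranspose Y) =
        (\<Sum>k\<in>UNIV. \<Sum>q\<in>UNIV. \<Sum>p\<in>UNIV. X $ k $ p * R $ p $ q * cnj (Y $ k $ q))" for X Y
      by (simp add: trace_def matrix_matrix_mult_def sum_distrib_right)
    have "trace (B ** R ** ctranspose B) = (\<Sum>k\<in>UNIV. \<Sum>q\<in>UNIV. \<Sum>p\<in>UNIV. \<Sum>j\<in>UNIV. \<Sum>i\<in>UNIV.
        cnj (w i) * w j * (chan S j $ k $ p * R $ p $ q * cnj (chan S i $ k $ q)))"
      unfolding tr B_def
      by (simp add: sum_distrib_left sum_distrib_right mult_ac)
    also have "\<dots> = (\<Sum>k\<in>UNIV. \<Sum>q\<in>UNIV. \<Sum>p\<in>UNIV. \<Sum>i\<in>UNIV. \<Sum>j\<in>UNIV.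
        cnj (w i) * w j * (chan S j $ k $ p * R $ p $ q * cnj (chan S i $ k $ q)))"
      by (rule sum.cong[OF refl], rule sum.cong[OF refl], rule sum.cong[OF refl], rule sum.swap)
    also have "\<dots> = (\<Sum>i\<in>UNIV. \<Sum>k\<in>UNIV. \<Sum>q\<in>UNIV. \<Sum>p\<in>UNIV. \<Sum>j\<in>UNIV.
        cnj (w i) * w j * (chan S j $ k $ p * R $ p $ q * cnj (chan S i $ k $ q)))"
      by (rule sum_rotate4)
    also have "\<dots> = (\<Sum>i\<in>UNIV. \<Sum>j\<in>UNIV. \<Sum>k\<in>UNIV. \<Sum>q\<in>UNIV. \<Sum>p\<in>UNIV.
        cnj (w i) * w j * (chan S j $ k $ p * R $ p $ q * cnj (chan S i $ k $ q)))"
      by (intro sum.cong refl sum_rotate4)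
    also have "\<dots> = herm_form (Fmat S R) v"
      unfolding herm_form_altdef entry tr
      by (simp add: w_def sum_distrib_left sum_distrib_right mult_ac)
    finally show ?thesis
      using Re_trace_congruence_nonneg[OF assms, of B] by simp
  qed
  with herm show ?thesis
    by (simp add: psd_iff)
qed

text \<open>The matrix under the determinant is affine in \<open>R\<close> and positive definite for
  \<open>psd R\<close>, so log-concavity of the determinant along segments passes to the
  rate.\<close>

lemma concave_on_C_sum:
  fixes S :: "('l::finite, 'mt::finite, 'mr::finite) isac"
  shows "concave_on {R. psd R} (C_sum S)"
proof -
  define r where "r = real (block_length S) / ((sigma_c S)\<^sup>2 + (sigma_z S)\<^sup>2)"
  define G where "G = (\<lambda>R. mat 1 + r *\<^sub>R Fmat S R)"
  have "r \<ge> 0"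
    by (simp add: r_def)
  then have pd: "pos_def (G R)" if "psd R" for R
    using that by (simp add: G_def pos_def_mat_1_add psd_Fmat)
  \<comment> \<open>HOL's \<open>ln\<close> satisfies \<open>ln x = ln \<bar>x\<bar>\<close>, so the sign of the determinant is irrelevant.\<close>
  have C: "C_sum S R = ln (cmod (det (G R))) / (real (block_length S) * ln 2)" if "psd R" for R
  proof -
    have "det (G R) \<in> \<real>"
      using that det_rate_real[of R r S] by (simp add: psd_def G_def)
    then have "cmod (det (G R)) = \<bar>Re (det (G R))\<bar>"
      using in_Reals_norm by blast
    then have "ln (cmod (det (G R))) = ln (Re (det (G R)))"
      by (simp add: abs_if ln_minus)
    then show ?thesis
      by (simp add: C_sum_def log_def G_def r_def)
  qed
  have "u * C_sum S R + v * C_sum S Q \<le> C_sum S (u *\<^sub>R R + v *\<^sub>R Q)"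
    if "psd R" "psd Q" and uv: "0 \<le> u" "0 \<le> v" "u + v = 1" for R Q u v
  proof -
    have psd: "psd (u *\<^sub>R R + v *\<^sub>R Q)"
      using convex_psd that unfolding convex_def by blast
    \<comment> \<open>Splitting the identity with the same weights makes \<open>G\<close> commute
      with convex combinations.\<close>
    have "mat 1 = u *\<^sub>R mat 1 + v *\<^sub>R (mat 1 :: complex^'l^'l)"
      using uv by (simp flip: scaleR_add_left)
    then have "G (u *\<^sub>R R + v *\<^sub>R Q) = u *\<^sub>R G R + v *\<^sub>R G Q"
      by (simp add: G_def linear_add[OF linear_Fmat] linear_scale[OF linear_Fmat] algebra_simps)
    moreover have "1 - v = u" "v \<le> 1" using uv by auto
    ultimately have "u * ln (cmod (det (G R))) + v * ln (cmod (det (G Q)))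
        \<le> ln (cmod (det (G (u *\<^sub>R R + v *\<^sub>R Q))))"
      using ln_det_concave[OF pd[OF that(1)] pd[OF that(2)] uv(2)] by simp
    then show ?thesis
      unfolding C[OF that(1)] C[OF that(2)] C[OF psd]
      by (simp add: divide_right_mono flip: add_divide_distrib)
  qed
  then show ?thesis
    using convex_psd by (simp add: concave_on_iff)
qed

section \<open>The 2x2 matrix inequalities and convexity of (P2)\<close>

lemma real_psd_2_iff:
  "real_psd (vector [vector [a, b], vector [b, d]] :: real^2^2) \<longleftrightarrow> 0 \<le> a \<and> 0 \<le> d \<and> b\<^sup>2 \<le> a * d"
proof -
  let ?A = "vector [vector [a, b], vector [b, d]] :: real^2^2"
  have "transpose ?A = ?A"
    by (simp add: vec_eq_iff forall_2 transpose_def)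
  moreover have "v \<bullet> (?A *v v) = a * (v $ 1)\<^sup>2 + 2 * b * (v $ 1) * (v $ 2) + d * (v $ 2)\<^sup>2" for v
    by (simp add: inner_vec_def matrix_vector_mult_def sum_2 algebra_simps power2_eq_square)
  ultimately have "real_psd ?A \<longleftrightarrow> (\<forall>x y. 0 \<le> a * x\<^sup>2 + 2 * b * x * y + d * y\<^sup>2)"
    by (simp add: real_psd_def forall_vector_2)
  also have "\<dots> \<longleftrightarrow> 0 \<le> a \<and> 0 \<le> d \<and> b\<^sup>2 \<le> a * d"
  proof safe
    assume *: "\<forall>x y. 0 \<le> a * x\<^sup>2 + 2 * b * x * y + d * y\<^sup>2"
    show a: "0 \<le> a" using *[rule_format, of 1 0] by simp
    show d: "0 \<le> d" using *[rule_format, of 0 1] by simp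
    show "b\<^sup>2 \<le> a * d"
    proof (cases "d = 0")
      case True
      have "0 \<le> a + 2 * b * t" for t
        using *[rule_format, of 1 t] True by simp
      \<comment> \<open>For \<open>b \<noteq> 0\<close> this choice of \<open>t\<close> makes the
        right-hand side equal to -1.\<close>
      from this[of "- (a + 1) / (2 * b)"] have "b = 0"
        using a by (cases "b = 0") auto
      with True show ?thesis by simp
    next
      case False
      \<comment> \<open>The vector (d, -b) spans the kernel of the second row, so the form there is
        \<open>d\<close> times the determinant.\<close>
      have "0 \<le> d * (a * d - b\<^sup>2)"
        using *[rule_format, of d "-b"] by (simp add: power2_eq_square algebra_simps)
      with False d show ?thesis by (simp add: zero_le_mult_iff)
    qed
  next
    fix x y
    assume "0 \<le> a" "0 \<le> d" and b: "b\<^sup>2 \<le> a * d"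
    show "0 \<le> a * x\<^sup>2 + 2 * b * x * y + d * y\<^sup>2"
    proof (cases "a = 0")
      case True
      with b \<open>0 \<le> d\<close> show ?thesis by simp
    next
      case False
      \<comment> \<open>Completing the square after multiplication by \<open>a > 0\<close>.\<close>
      have "a * (a * x\<^sup>2 + 2 * b * x * y + d * y\<^sup>2) = (a * x + b * y)\<^sup>2 + (a * d - b\<^sup>2) * y\<^sup>2"
        by (simp add: power2_eq_square algebra_simps)
      also have "0 \<le> \<dots>" using b by simp
      finally show ?thesis
        using False \<open>0 \<le> a\<close> by (simp add: zero_le_mult_iff)
    qed
  qed
  finally show ?thesis .
qed

lemma convex_real_psd: "convex {A. real_psd A}"
proof (rule convexI)
  fix A B :: "real^'a^'a" and u v :: real
  assume *: "A \<in> {A. real_psd A}" "B \<in> {A. real_psd A}" "0 \<le> u" "0 \<le> v"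
  have "transpose (u *\<^sub>R A + v *\<^sub>R B) = u *\<^sub>R transpose A + v *\<^sub>R transpose B"
    by (simp add: vec_eq_iff transpose_def)
  with * show "u *\<^sub>R A + v *\<^sub>R B \<in> {A. real_psd A}"
    by (simp add: real_psd_def matrix_vector_mult_add_rdistrib inner_add_right
        flip: scaleR_matrix_vector_assoc)
qed

text \<open>All entries are linear in the covariance and the bound variable jointly, so the
  constraint is a preimage of the convex cone of semidefinite matrices.\<close>

lemma LMI_tau_affine:
  assumes "u + v = 1"
  shows "LMI_tau S l (u *\<^sub>R R + v *\<^sub>R Q) (u * a + v * b) = u *\<^sub>R LMI_tau S l R a + v *\<^sub>R LMI_tau S l Q b"
  unfolding LMI_tau_def
  by (simp add: vec_eq_iff forall_2 linear_add[OF linear_f_tr] linear_scale[OF linear_f_tr]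
      linear_add[OF linear_g_tr] linear_scale[OF linear_g_tr]
      linear_add[OF linear_h_tr] linear_scale[OF linear_h_tr] algebra_simps add_divide_distrib)

lemma LMI_phi_affine:
  assumes "u + v = 1"
  shows "LMI_phi S l (u *\<^sub>R R + v *\<^sub>R Q) (u * a + v * b) = u *\<^sub>R LMI_phi S l R a + v *\<^sub>R LMI_phi S l Q b"
  unfolding LMI_phi_def
  by (simp add: vec_eq_iff forall_2 linear_add[OF linear_f_tr] linear_scale[OF linear_f_tr]
      linear_add[OF linear_g_tr] linear_scale[OF linear_g_tr]
      linear_add[OF linear_h_tr] linear_scale[OF linear_h_tr] algebra_simps add_divide_distrib)

lemma convex_P2_feasible:
  fixes S :: "('l::finite, 'mt::finite, 'mr::{finite,linorder}) isac"
  shows "convex (P2_feasible S)"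
proof (rule convexI)
  fix x y :: "(complex^'mt^'mt) \<times> (real^'l) \<times> (real^'l)" and u v :: real
  assume x: "x \<in> P2_feasible S" and y: "y \<in> P2_feasible S"
    and uv: "0 \<le> u" "0 \<le> v" "u + v = 1"
  obtain R w n where x_eq: "x = (R, w, n)" by (cases x)
  obtain Q w' n' where y_eq: "y = (Q, w', n')" by (cases y)
  have R: "psd R" and w: "\<And>l. w $ l > 0" "\<And>l. n $ l > 0"
    and PR: "pulse_power S * Re (trace R) \<le> power_budget S"
    and CR: "rate_threshold S \<le> C_sum S R"
    and LR: "\<And>l. real_psd (LMI_tau S l R (w $ l))" "\<And>l. real_psd (LMI_phi S l R (n $ l))"
    using x by (auto simp: x_eq P2_feasible_def)
  have Q: "psd Q" and w': "\<And>l. w' $ l > 0" "\<And>l. n' $ l > 0"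
    and PQ: "pulse_power S * Re (trace Q) \<le> power_budget S"
    and CQ: "rate_threshold S \<le> C_sum S Q"
    and LQ: "\<And>l. real_psd (LMI_tau S l Q (w' $ l))" "\<And>l. real_psd (LMI_phi S l Q (n' $ l))"
    using y by (auto simp: y_eq P2_feasible_def)
  have "psd (u *\<^sub>R R + v *\<^sub>R Q)"
    using convex_psd R Q uv unfolding convex_def by blast
  \<comment> \<open>The weights sum to 1, so they cannot both vanish and strictness
    survives.\<close>
  moreover have "0 < u * a + v * b" if "0 < a" "0 < b" for a b
    using that uv by (cases "u = 0") (auto intro: add_pos_nonneg)
  moreover have "pulse_power S * Re (trace (u *\<^sub>R R + v *\<^sub>R Q)) \<le> power_budget S"
    using convex_bound_le[OF PR PQ uv] by (simp add: trace_add trace_scaleR algebra_simps)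
  moreover have "rate_threshold S \<le> C_sum S (u *\<^sub>R R + v *\<^sub>R Q)"
  proof -
    have "rate_threshold S = u * rate_threshold S + v * rate_threshold S"
      using uv by (simp flip: distrib_right)
    also have "\<dots> \<le> u * C_sum S R + v * C_sum S Q"
      using CR CQ uv by (intro add_mono mult_left_mono) auto
    also have "\<dots> \<le> C_sum S (u *\<^sub>R R + v *\<^sub>R Q)"
      using concave_on_C_sum[of S] R Q uv unfolding concave_on_iff by blast
    finally show ?thesis .
  qed
  moreover have "real_psd (LMI_tau S l (u *\<^sub>R R + v *\<^sub>R Q) (u * w $ l + v * w' $ l))" for l
    unfolding LMI_tau_affine[OF uv(3)]
    using convexD[OF convex_real_psd _ _ uv] LR LQ by blast
  moreover have "real_psd (LMI_phi S l (u *\<^sub>R R + v *\<^sub>R Q) (u * n $ l + v * n' $ l))" for l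
    unfolding LMI_phi_affine[OF uv(3)]
    using convexD[OF convex_real_psd _ _ uv] LR LQ by blast
  ultimately show "u *\<^sub>R x + v *\<^sub>R y \<in> P2_feasible S"
    using w w' by (simp add: x_eq y_eq P2_feasible_def)
qed

text \<open>The objective is separable into terms \<open>- (1 / x)\<close>, each concave on the
  positive half-line, where feasibility keeps all coordinates.\<close>

lemma concave_on_P2_objective:
  fixes S :: "('l::finite, 'mt::finite, 'mr::{finite,linorder}) isac"
  shows "concave_on (P2_feasible S) P2_objective"
  unfolding concave_on_iff
proof (intro conjI convex_P2_feasible ballI allI impI)
  fix x y :: "(complex^'mt^'mt) \<times> (real^'l) \<times> (real^'l)" and u v :: real
  assume x: "x \<in> P2_feasible S" and y: "y \<in> P2_feasible S"
    and uv: "0 \<le> u" "0 \<le> v" "u + v = 1"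
  obtain R w n where x_eq: "x = (R, w, n)" by (cases x)
  obtain Q w' n' where y_eq: "y = (Q, w', n')" by (cases y)
  have pos: "0 < w $ l" "0 < n $ l" "0 < w' $ l" "0 < n' $ l" for l
    using x y by (auto simp: x_eq y_eq P2_feasible_def)
  have inv: "u * - (1 / a) + v * - (1 / b) \<le> - (1 / (u * a + v * b))" if "0 < a" "0 < b" for a b
  proof -
    have "inverse (u * a + v * b) \<le> u * inverse a + v * inverse b"
      using convex_on_inverse[of "{0<..}"] that uv by (simp add: convex_on_def)
    then show ?thesis
      by (simp add: inverse_eq_divide)
  qed
  have sum: "u * (\<Sum>l\<in>UNIV. - (1 / p $ l)) + v * (\<Sum>l\<in>UNIV. - (1 / q $ l))
      \<le> (\<Sum>l\<in>UNIV. - (1 / (u *\<^sub>R p + v *\<^sub>R q) $ l))"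
    if "\<And>l. 0 < p $ l" "\<And>l. 0 < q $ l" for p q :: "real^'l"
    unfolding sum_distrib_left sum.distrib[symmetric]
    using inv that by (intro sum_mono) simp
  show "u * P2_objective x + v * P2_objective y \<le> P2_objective (u *\<^sub>R x + v *\<^sub>R y)"
    using sum[of w w'] sum[of n n'] pos
    by (simp add: x_eq y_eq P2_objective_def algebra_simps)
qed

section \<open>The matrix inequalities as bounds on \<omega> and \<nu>\<close>

text \<open>A Schur complement: for \<open>d > 0\<close> semidefiniteness means
  \<open>k * w \<le> a - b\<^sup>2 / d\<close>. As \<open>k * w > 0\<close>, this also forces
  \<open>a\<close> and the unshifted determinant to be positive. One matrix inequality alone would
  allow \<open>b = d = 0\<close>, hence the conjunct \<open>0 < d\<close>.\<close>

lemma LMI_le_iff: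
  fixes a d b k w :: real
  assumes "0 < w" "0 < k"
  shows "real_psd (vector [vector [a - k * w, b], vector [b, d]] :: real^2^2) \<and> 0 < d
    \<longleftrightarrow> 0 < a \<and> 0 < d \<and> 0 < a * d - b\<^sup>2 \<and> w \<le> (a * d - b\<^sup>2) / (k * d)"
proof (cases "0 < d")
  case True
  have kw: "0 < k * w" "0 < k * w * d"
    using assms True by simp_all
  have le: "w \<le> (a * d - b\<^sup>2) / (k * d) \<longleftrightarrow> b\<^sup>2 \<le> (a - k * w) * d"
    using assms True by (simp add: pos_le_divide_eq algebra_simps)
  have "0 \<le> a - k * w" if "b\<^sup>2 \<le> (a - k * w) * d"
    using order_trans[OF zero_le_power2 that] True by (simp add: zero_le_mult_iff)
  moreover have "0 < a * d - b\<^sup>2" if "b\<^sup>2 \<le> (a - k * w) * d"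
    using that kw by (simp add: algebra_simps)
  ultimately show ?thesis
    unfolding real_psd_2_iff le using True kw by auto
qed simp

text \<open>Eliminates the matrix inequalities. In particular, they already enforce the standing
  positivity restrictions that (P1) states explicitly.\<close>

lemma P2_feasible_iff:
  fixes S :: "('l::finite, 'mt::finite, 'mr::{finite,linorder}) isac"
  assumes "eps_g S > 0" "F2 S > 0" "\<And>l. xi S l > 0" "\<And>l. c_const S l > 0"
  shows "(R, \<omega>, \<nu>) \<in> P2_feasible S \<longleftrightarrow> R \<in> P1_feasible S \<and>
    (\<forall>l. 0 < \<omega> $ l \<and> \<omega> $ l \<le> 1 / CRB_tau S l R \<and> 0 < \<nu> $ l \<and> \<nu> $ l \<le> 1 / CRB_phi S l R)"
proof -
  have "real_psd (LMI_tau S l R w) \<and> real_psd (LMI_phi S l R v) \<longleftrightarrow>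
      (0 < f_tr S l R \<and> 0 < h_tr S l R \<and> 0 < crb_denom S l R)
      \<and> w \<le> 1 / CRB_tau S l R \<and> v \<le> 1 / CRB_phi S l R"
    if "0 < w" "0 < v" for l w v
  proof -
    \<comment> \<open>\<open>a\<close>, \<open>d\<close> and \<open>b\<close> are the entries shared
      by both matrices before the shift by the bound variable. \<open>crb_denom\<close> is their
      determinant, and the reciprocal bounds are positive multiples of the two Schur complements
      when \<open>a\<close> and \<open>d\<close> are positive.\<close>
    define a where "a = eps_g S * F2 S * f_tr S l R"
    define d where "d = eps_g S * h_tr S l R"
    define b where "b = cmod (eps_dg S) * g_tr S l R"
    have denom: "crb_denom S l R = a * d - b\<^sup>2"
      by (simp add: crb_denom_def a_def b_def d_def power2_eq_square algebra_simps)
    have tau: "1 / CRB_tau S l R = (a * d - b\<^sup>2) / (1 / xi S l * d)"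
      by (simp add: CRB_tau_def denom flip: d_def)
    have phi: "1 / CRB_phi S l R = (d * a - b\<^sup>2) / (c_const S l / xi S l * a)"
      by (simp add: CRB_phi_def denom flip: a_def) (simp add: mult.commute)
    have k: "0 < 1 / xi S l" "0 < c_const S l / xi S l"
      using assms by simp_all
    have pos: "0 < f_tr S l R \<longleftrightarrow> 0 < a" "0 < h_tr S l R \<longleftrightarrow> 0 < d"
      using assms(1,2) by (auto simp: a_def d_def zero_less_mult_iff mult_less_0_iff)
    have Mt: "LMI_tau S l R w = vector [vector [a - 1 / xi S l * w, b], vector [b, d]]"
      by (simp add: LMI_tau_def a_def b_def d_def)
    have Mp: "LMI_phi S l R v = vector [vector [d - c_const S l / xi S l * v, b], vector [b, a]]"
      by (simp add: LMI_phi_def a_def b_def d_def)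
    \<comment> \<open>The shifted diagonal entries are nonnegative and the shifts positive. Each
      inequality thus supplies the strict positivity that \<open>LMI_le_iff\<close> requires for the
      other.\<close>
    have "0 < a" "0 < d" if "real_psd (LMI_tau S l R w)" "real_psd (LMI_phi S l R v)"
      using that mult_pos_pos[OF k(1) \<open>0 < w\<close>] mult_pos_pos[OF k(2) \<open>0 < v\<close>]
      unfolding Mt Mp real_psd_2_iff by linarith+
    then show ?thesis
      using LMI_le_iff[OF that(1) k(1), of a b d] LMI_le_iff[OF that(2) k(2), of d b a]
      unfolding Mt[symmetric] Mp[symmetric] pos denom tau phi by (auto simp: mult.commute)
  qed
  then show ?thesis
    unfolding P2_feasible_def P1_feasible_def mem_Collect_eq prod.case diff_ge_0_iff_ge by blast
qed

lemma CRB_pos: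
  assumes "eps_g S > 0" "F2 S > 0" "\<And>l. xi S l > 0" "\<And>l. c_const S l > 0"
    and "R \<in> P1_feasible S"
  shows "0 < CRB_tau S l R" "0 < CRB_phi S l R"
  using assms by (auto simp: P1_feasible_def CRB_tau_def CRB_phi_def)

text \<open>Upper bound on the objective: \<open>\<omega> \<le> 1 / CRB\<close> is inverted to
  \<open>CRB \<le> 1 / \<omega>\<close>, likewise for \<open>\<nu>\<close>, and summed over the
  paths.\<close>

lemma P2_feasible_imp:
  assumes "eps_g S > 0" "F2 S > 0" "\<And>l. xi S l > 0" "\<And>l. c_const S l > 0"
    and "(R, \<omega>, \<nu>) \<in> P2_feasible S"
  shows "R \<in> P1_feasible S" "P2_objective (R, \<omega>, \<nu>) \<le> - CRB S R"
proof -
  note * = assms(5)[unfolded P2_feasible_iff[OF assms(1-4)]]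
  show R: "R \<in> P1_feasible S"
    using * by blast
  have le: "x \<le> 1 / w" if "0 < w" "w \<le> 1 / x" "0 < x" for w x :: real
    using that by (simp add: field_simps)
  have "CRB_tau S l R \<le> 1 / \<omega> $ l" "CRB_phi S l R \<le> 1 / \<nu> $ l" for l
    using * le CRB_pos[OF assms(1-4) R] by blast+
  then have "CRB S R \<le> (\<Sum>l\<in>UNIV. 1 / \<omega> $ l + 1 / \<nu> $ l)"
    unfolding CRB_def by (intro sum_mono add_mono)
  then show "P2_objective (R, \<omega>, \<nu>) \<le> - CRB S R"
    by (simp add: P2_objective_def sum.distrib sum_negf)
qed

lemma P1_feasible_imp:
  assumes "eps_g S > 0" "F2 S > 0" "\<And>l. xi S l > 0" "\<And>l. c_const S l > 0"
    and "R \<in> P1_feasible S"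
  shows "\<exists>\<omega> \<nu>. (R, \<omega>, \<nu>) \<in> P2_feasible S \<and> P2_objective (R, \<omega>, \<nu>) = - CRB S R"
proof (intro exI conjI)
  \<comment> \<open>Both bounds are taken with equality, so each reciprocal in the objective becomes
    an individual CRB.\<close>
  let ?x = "(R, (\<chi> l. 1 / CRB_tau S l R), (\<chi> l. 1 / CRB_phi S l R))"
  show "?x \<in> P2_feasible S"
    unfolding P2_feasible_iff[OF assms(1-4)] using assms(5) CRB_pos[OF assms] by simp
  show "P2_objective ?x = - CRB S R"
    by (simp add: P2_objective_def CRB_def sum.distrib sum_negf)
qed

section \<open>Transfer of optimal solutions and optimal values\<close>

theorem mainTheorem4:
  fixes S :: "('l::finite, 'mt::{finite,linorder}, 'mr::{finite,linorder}) isac"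
  assumes chan: "\<And>l. chan S l = outer_product (steering (spacing_R S) (wavelength S) (aoa S l))
                                                (steering (spacing_T S) (wavelength S) (aod S l))"
    and xi_pos: "\<And>l. xi S l > 0"
    and c_pos: "\<And>l. c_const S l > 0"
    and pulse_diff: "negligible {t \<in> {0..duration S}.
                       \<not> pulse S differentiable (at t within {0..duration S})}"
    and int_g: "(\<lambda>t. (cmod (pulse S t))\<^sup>2) integrable_on {0..duration S}"
    and int_dg: "(\<lambda>t. (cmod (pulse_deriv S t))\<^sup>2) integrable_on {0..duration S}"
    and int_dg_g: "(\<lambda>t. cnj (pulse_deriv S t) * pulse S t) integrable_on {0..duration S}"
    and eps_g_pos: "eps_g S > 0"
    and F2_pos: "F2 S > 0"
    and pulse_power: "pulse_power S = 1"
    and budget_pos: "power_budget S > 0"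
    and N_pos: "block_length S > 0"
    and s_pos: "\<And>l. sc S l > 0"
    and alpha_pos: "\<And>l. alpha S l > 0"
    and noise_pos: "(sigma_c S)\<^sup>2 + (sigma_z S)\<^sup>2 > 0"
  shows "convex (P2_feasible S) \<and> concave_on (P2_feasible S) P2_objective
    \<and> (\<forall>R. is_arg_min (CRB S) (\<lambda>R. R \<in> P1_feasible S) R \<longleftrightarrow>
            (\<exists>\<omega> \<nu>. is_arg_max P2_objective (\<lambda>x. x \<in> P2_feasible S) (R, \<omega>, \<nu>)))
    \<and> (SUP x\<in>P2_feasible S. ereal (P2_objective x)) = - (INF R\<in>P1_feasible S. ereal (CRB S R))"
proof (intro conjI allI)
  note params = eps_g_pos F2_pos xi_pos c_pos
  note P2_imp = P2_feasible_imp[OF params]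
  note P1_imp = P1_feasible_imp[OF params]
  show "convex (P2_feasible S)" "concave_on (P2_feasible S) P2_objective"
    by (rule convex_P2_feasible concave_on_P2_objective)+
  show "is_arg_min (CRB S) (\<lambda>R. R \<in> P1_feasible S) R \<longleftrightarrow>
      (\<exists>\<omega> \<nu>. is_arg_max P2_objective (\<lambda>x. x \<in> P2_feasible S) (R, \<omega>, \<nu>))" for R
  proof
    assume R: "is_arg_min (CRB S) (\<lambda>R. R \<in> P1_feasible S) R"
    then obtain \<omega> \<nu> where x: "(R, \<omega>, \<nu>) \<in> P2_feasible S" "P2_objective (R, \<omega>, \<nu>) = - CRB S R"
      using P1_imp unfolding is_arg_min_def by blast
    \<comment> \<open>Projecting \<open>y\<close> to its covariance \<open>Q\<close> gives the
      chain: objective of \<open>y\<close> \<le> - CRB(Q) \<le> - CRB(R).\<close>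
    have "P2_objective y \<le> P2_objective (R, \<omega>, \<nu>)" if "y \<in> P2_feasible S" for y
    proof -
      obtain Q \<omega>' \<nu>' where y: "y = (Q, \<omega>', \<nu>')" by (cases y)
      have "CRB S R \<le> CRB S Q"
        using R P2_imp(1) that unfolding y is_arg_min_def by force
      then show ?thesis
        using P2_imp(2) that x(2) unfolding y by fastforce
    qed
    with x(1) show "\<exists>\<omega> \<nu>. is_arg_max P2_objective (\<lambda>x. x \<in> P2_feasible S) (R, \<omega>, \<nu>)"
      unfolding is_arg_max_def by (metis not_less)
  next
    assume "\<exists>\<omega> \<nu>. is_arg_max P2_objective (\<lambda>x. x \<in> P2_feasible S) (R, \<omega>, \<nu>)"
    then obtain \<omega> \<nu> where x: "(R, \<omega>, \<nu>) \<in> P2_feasible S"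
      and max: "\<And>y. y \<in> P2_feasible S \<Longrightarrow> P2_objective y \<le> P2_objective (R, \<omega>, \<nu>)"
      unfolding is_arg_max_def by (auto simp: not_less)
    \<comment> \<open>Conversely, \<open>Q\<close> lifts to a point of objective - CRB(Q), which
      maximality bounds by the objective at \<open>R\<close>, itself at most - CRB(R).\<close>
    have "CRB S R \<le> CRB S Q" if "Q \<in> P1_feasible S" for Q
    proof -
      obtain \<omega>' \<nu>' where "(Q, \<omega>', \<nu>') \<in> P2_feasible S" "P2_objective (Q, \<omega>', \<nu>') = - CRB S Q"
        using P1_imp \<open>Q \<in> P1_feasible S\<close> by blast
      then show ?thesis
        using max[of "(Q, \<omega>', \<nu>')"] P2_imp(2)[OF x] by linarith
    qed
    then show "is_arg_min (CRB S) (\<lambda>R. R \<in> P1_feasible S) R"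
      using P2_imp(1)[OF x] unfolding is_arg_min_def by (metis not_less)
  qed
  \<comment> \<open>Extended reals cover unattained optima and empty feasible sets, where both sides
    are -\<infinity>.\<close>
  have "(SUP x\<in>P2_feasible S. ereal (P2_objective x)) = (SUP R\<in>P1_feasible S. - ereal (CRB S R))"
  proof (rule antisym)
    show "(SUP x\<in>P2_feasible S. ereal (P2_objective x)) \<le> (SUP R\<in>P1_feasible S. - ereal (CRB S R))"
    proof (rule SUP_least)
      fix x assume x: "x \<in> P2_feasible S"
      obtain R \<omega> \<nu> where x_eq: "x = (R, \<omega>, \<nu>)" by (cases x)
      show "ereal (P2_objective x) \<le> (SUP R\<in>P1_feasible S. - ereal (CRB S R))"
        using P2_imp[OF x[unfolded x_eq]] by (intro SUP_upper2[of R]) (simp_all add: x_eq)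
    qed
    show "(SUP R\<in>P1_feasible S. - ereal (CRB S R)) \<le> (SUP x\<in>P2_feasible S. ereal (P2_objective x))"
    proof (rule SUP_least)
      fix R assume "R \<in> P1_feasible S"
      then obtain \<omega> \<nu> where "(R, \<omega>, \<nu>) \<in> P2_feasible S" "P2_objective (R, \<omega>, \<nu>) = - CRB S R"
        using P1_imp by blast
      then show "- ereal (CRB S R) \<le> (SUP x\<in>P2_feasible S. ereal (P2_objective x))"
        by (intro SUP_upper2[of "(R, \<omega>, \<nu>)"]) simp_all
    qed
  qed
  then show "(SUP x\<in>P2_feasible S. ereal (P2_objective x)) = - (INF R\<in>P1_feasible S. ereal (CRB S R))"
    by (simp only: ereal_SUP_uminus_eq)
qed

end
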